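(* Let $\Gamma$ be a finite, connected, simple graph with spanning tree $T$ and with vertices labelled as described in the context, and let $\tilde f_2:\operatorname{Sym}^2(\Gamma)\to\mathbb{R}$ be the function on the cells of $\operatorname{Sym}^2(\Gamma)$ defined in the context. Then $\tilde f_2$ is a discrete Morse function on the regular CW complex $\operatorname{Sym}^2(\Gamma)$ for which every cell of $\Delta$ is critical, and the restriction of $\tilde f_2$ to the cells of the open cell complex $C_2(\Gamma)=\operatorname{Sym}^2(\Gamma)\setminus\Delta$ is an open discrete Morse function.
   Context: **Labelling.** $T$ is a spanning tree of $\Gamma$ (a subtree containing all vertices), drawn in the plane. Choose a vertex having valency $1$ in $T$ and label it $1$; then traverse $T$ anticlockwise (depth-first) starting at $1$ and label the vertices $2,3,\dots$ in the order in which they are first met. Vertices are identified with their labels. For each vertex $v\neq 1$ let $\tau(v)$ be the neighbour of $v$ on the path in $T$ from $v$ to $1$ (so $\tau(v)<v$) and let $e(v)=(v,\tau(v))$; then $v\mapsto e(v)$ is a bijection from $V(\Gamma)\setminus\{1\}$ to $E(T)$. "$e\in\Gamma-T$" means that $e$ is an edge of $\Gamma$ not in $T$. **The cell complex.** $\operatorname{Sym}^2(\Gamma)=(\Gamma\times\Gamma)/\big((x,y)\sim(y,x)\big)$ and $\Delta$ is the image of the diagonal. $\operatorname{Sym}^2(\Gamma)$ has a regular CW structure with the following cells, where products are unordered ($a\times b=b\times a$). - $0$-cells: $i\times j$ for vertices $i,j$ (possibly equal). - $1$-cells: $i\times e$ for a vertex $i$ and an edge $e$; and for each edge $e=(i,j)$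 a diagonal cell $D(e)=D(i,j)$ with faces $i\times i$ and $j\times j$. - $2$-cells: $e\times e'$ for distinct edges $e\neq e'$, with the four product $1$-faces $a\times e'$ ($a$ an endpoint of $e$) and $e\times b$ ($b$ an endpoint of $e'$); and for each edge $e=(i,j)$ a triangle $C_2(e)$ (the image of the square $e\times e$) with $1$-faces $i\times e$, $j\times e$ and $D(e)$. $\Delta$ is the subcomplex consisting of the cells $i\times i$ and $D(e)$; the cells of $C_2(\Gamma)=\operatorname{Sym}^2(\Gamma)\setminus\Delta$ are all the other cells. **The functions.** Define $f_1$ on the cells of $\Gamma$ by $f_1(i)=2i-2$ for vertices, $f_1((i,j))=\max\{f_1(i),f_1(j)\}$ if $(i,j)\in T$, and $f_1((i,j))=\max\{f_1(i),f_1(j)\}+2$ if $(i,j)\in\Gamma-T$. Define $f_2$ on cells of $C_2(\Gamma)$ by $f_2(i\times j)=f_1(i)+f_1(j)$ for $i\ne j$, $f_2(i\times e)=f_1(i)+f_1(e)$, $f_2(e\times e')=f_1(e)+f_1(e')$ for $e\neq e'$, and $f_2(C_2(e))=2f_1(e)$; and on cells of $\Delta$ by $f_2(i\times i)=-4$ and $f_2(D(e))=-2$. The function $\tilde f_2$ is obtained from $f_2$ by the following change: for every pair of vertices $u<v$ with $u,v\neq 1$, set $\tilde f_2(e(u)\times e(v))=f_2(e(u)\times e(v))+1$ and $\tilde f_2(u\times e(v))=f_2(u\times e(v))+1$; on all other cells $\tilde f_2=f_2$. **Discrete Morse functions.** A real function $f$ on the cells of a regular CW complex $M$ is a discrete Morse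 function if for every $p$-cell $\sigma$ one has $\#\{\tau^{(p+1)}>\sigma : f(\tau)\le f(\sigma)\}\le 1$ and $\#\{\nu^{(p-1)}<\sigma : f(\nu)\ge f(\sigma)\}\le 1$, where $\tau>\sigma$ means $\sigma$ is a face of $\tau$. The cell $\sigma$ is critical if both inequalities are strict (both sets are empty). If $K=X\setminus S$ with $X$ a regular CW complex and $S$ a nonempty subcomplex, a real function $f$ on the cells of $K$ is an open discrete Morse function if for every $p$-cell $\sigma$ of $K$ one has $\#\{\tau^{(p+1)}>\sigma : \tau\in K,\ f(\tau)\le f(\sigma)\}\le 1$ and $\#\{\nu^{(p-1)}<\sigma : \nu\in K,\ f(\nu)\ge f(\sigma)\}\le 1$, with at least one of the two inequalities strict. *)

theory Defs
  imports Complex_Main "HOL-Library.Multiset" "HOL-Combinatorics.Orbits"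
begin

section \<open>Graphs and spanning trees\<close>

text \<open>An edge joining \<open>u\<close> and \<open>v\<close> is the two-element set \<open>{u, v}\<close>.\<close>

definition simple_graph :: "'a set \<Rightarrow> 'a set set \<Rightarrow> bool" where
  "simple_graph V E \<longleftrightarrow> (\<forall>e\<in>E. e \<subseteq> V \<and> card e = 2)"

definition is_walk :: "'a set set \<Rightarrow> 'a \<Rightarrow> 'a list \<Rightarrow> 'a \<Rightarrow> bool" where
  "is_walk E u p v \<longleftrightarrow>
     p \<noteq> [] \<and> hd p = u \<and> last p = v \<and> successively (\<lambda>x y. {x, y} \<in> E) p"

definition is_path :: "'a set set \<Rightarrow> 'a \<Rightarrow> 'a list \<Rightarrow> 'a \<Rightarrow> bool" where
  "is_path E u p v \<longleftrightarrow> is_walk E u p v \<and> distinct p"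

definition connected_graph :: "'a set \<Rightarrow> 'a set set \<Rightarrow> bool" where
  "connected_graph V E \<longleftrightarrow> V \<noteq> {} \<and> (\<forall>u\<in>V. \<forall>v\<in>V. \<exists>p. is_walk E u p v)"

definition is_cycle :: "'a set set \<Rightarrow> 'a list \<Rightarrow> bool" where
  "is_cycle E p \<longleftrightarrow>
     length p \<ge> 3 \<and> distinct p \<and> successively (\<lambda>x y. {x, y} \<in> E) p \<and> {last p, hd p} \<in> E"

definition tree :: "'a set \<Rightarrow> 'a set set \<Rightarrow> bool" where
  "tree V T \<longleftrightarrow> simple_graph V T \<and> connected_graph V T \<and> (\<nexists>p. is_cycle T p)"

definition spanning_tree :: "'a set \<Rightarrow> 'a set set \<Rightarrow> 'a set set \<Rightarrow> bool" where
  "spanning_tree V E T \<longleftrightarrow> T \<subseteq> E \<and> tree V T"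

definition nbrs :: "'a set set \<Rightarrow> 'a \<Rightarrow> 'a set" where
  "nbrs T v = {u. {v, u} \<in> T}"


section \<open>The labelling\<close>

text \<open>
  A drawing of the tree in the plane is recorded, up to isotopy, by its rotation system:
  \<open>rot v\<close> cyclically permutes the neighbours of \<open>v\<close> in the order in which the edges leave \<open>v\<close>.
  For a tree every rotation system comes from a drawing. \<open>cyclic_on\<close> says that the
  neighbours of \<open>v\<close> form a single orbit of \<open>rot v\<close>.
\<close>

definition plane_drawing :: "'a set \<Rightarrow> 'a set set \<Rightarrow> ('a \<Rightarrow> 'a \<Rightarrow> 'a) \<Rightarrow> bool" where
  "plane_drawing V T rot \<longleftrightarrow> (\<forall>v\<in>V. cyclic_on (rot v) (nbrs T v))"

text \<open>
  The walk around the tree that starts at the vertex \<open>r\<close> of valency 1. Its state is the pair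
  of the present vertex and the next one; having reached \<open>v\<close> from \<open>u\<close>, the walk leaves along
  the edge that follows the edge to \<open>u\<close> in the rotation at \<open>v\<close>. This is the depth-first
  traversal (it backtracks exactly when the subtree it is in is exhausted).
\<close>

primrec contour :: "'a set set \<Rightarrow> ('a \<Rightarrow> 'a \<Rightarrow> 'a) \<Rightarrow> 'a \<Rightarrow> nat \<Rightarrow> 'a \<times> 'a" where
  "contour T rot r 0 = (r, the_elem (nbrs T r))"
| "contour T rot r (Suc k) = (case contour T rot r k of (u, v) \<Rightarrow> (v, rot v u))"

definition met_before :: "'a set set \<Rightarrow> ('a \<Rightarrow> 'a \<Rightarrow> 'a) \<Rightarrow> 'a \<Rightarrow> 'a \<Rightarrow> 'a \<Rightarrow> bool" where
  "met_before T rot r i j \<longleftrightarrow>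
     (\<exists>k. fst (contour T rot r k) = i \<and> (\<forall>l\<le>k. fst (contour T rot r l) \<noteq> j))"

text \<open>
  Vertices are identified with their labels, so the vertex set is \<open>{1..n}\<close>, and the labelling
  rule becomes a condition on the tree and its drawing.
\<close>

definition dfs_labelled :: "nat set \<Rightarrow> nat set set \<Rightarrow> (nat \<Rightarrow> nat \<Rightarrow> nat) \<Rightarrow> bool" where
  "dfs_labelled V T rot \<longleftrightarrow>
     1 \<in> V \<and> card (nbrs T 1) = 1 \<and>
     (\<forall>i\<in>V. \<forall>j\<in>V. i < j \<longrightarrow> met_before T rot 1 i j)"

definition parent :: "nat set set \<Rightarrow> nat \<Rightarrow> nat" where
  "parent T v = (THE w. \<exists>ps. is_path T v (v # w # ps) 1)"

definition tree_edge :: "nat set set \<Rightarrow> nat \<Rightarrow> nat set" where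
  "tree_edge T v = {v, parent T v}"


section \<open>Cell complexes and discrete Morse functions\<close>

text \<open>
  The notions below only involve the cells of a regular CW complex, their dimensions and the
  relation \<open>face X \<sigma> \<tau>\<close>: the cell \<open>\<sigma>\<close> is a proper face of the cell \<open>\<tau>\<close>. A complex is
  represented by these data.
\<close>

record 'c cell_complex =
  cells :: "'c set"
  cdim :: "'c \<Rightarrow> nat"
  face :: "'c \<Rightarrow> 'c \<Rightarrow> bool"

definition subcomplex :: "'c set \<Rightarrow> 'c cell_complex \<Rightarrow> bool" where
  "subcomplex S X \<longleftrightarrow>
     S \<subseteq> cells X \<and> (\<forall>\<sigma>\<in>cells X. \<forall>\<tau>\<in>S. face X \<sigma> \<tau> \<longrightarrow> \<sigma> \<in> S)"

definition upper_exc :: "'c cell_complex \<Rightarrow> ('c \<Rightarrow> real) \<Rightarrow> 'c \<Rightarrow> 'c set" where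
  "upper_exc X f \<sigma> =
     {\<tau> \<in> cells X. cdim X \<tau> = cdim X \<sigma> + 1 \<and> face X \<sigma> \<tau> \<and> f \<tau> \<le> f \<sigma>}"

definition lower_exc :: "'c cell_complex \<Rightarrow> ('c \<Rightarrow> real) \<Rightarrow> 'c \<Rightarrow> 'c set" where
  "lower_exc X f \<sigma> =
     {\<nu> \<in> cells X. cdim X \<sigma> = cdim X \<nu> + 1 \<and> face X \<nu> \<sigma> \<and> f \<nu> \<ge> f \<sigma>}"

definition at_most_one :: "'c set \<Rightarrow> bool" where
  "at_most_one A \<longleftrightarrow> finite A \<and> card A \<le> 1"

definition discrete_Morse :: "'c cell_complex \<Rightarrow> ('c \<Rightarrow> real) \<Rightarrow> bool" where
  "discrete_Morse X f \<longleftrightarrow>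
     (\<forall>\<sigma>\<in>cells X. at_most_one (upper_exc X f \<sigma>) \<and> at_most_one (lower_exc X f \<sigma>))"

definition critical :: "'c cell_complex \<Rightarrow> ('c \<Rightarrow> real) \<Rightarrow> 'c \<Rightarrow> bool" where
  "critical X f \<sigma> \<longleftrightarrow> \<sigma> \<in> cells X \<and> upper_exc X f \<sigma> = {} \<and> lower_exc X f \<sigma> = {}"

definition open_complex :: "'c cell_complex \<Rightarrow> 'c set \<Rightarrow> 'c cell_complex" where
  "open_complex X S = X\<lparr>cells := cells X - S\<rparr>"

text \<open>
  Only the values of \<open>f\<close> on the cells outside \<open>S\<close> matter, so this speaks about the restriction
  of \<open>f\<close> to those cells.
\<close>

definition open_discrete_Morse :: "'c cell_complex \<Rightarrow> 'c set \<Rightarrow> ('c \<Rightarrow> real) \<Rightarrow> bool" where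
  "open_discrete_Morse X S f \<longleftrightarrow>
     subcomplex S X \<and> S \<noteq> {} \<and>
     (let K = open_complex X S in
       \<forall>\<sigma>\<in>cells K. at_most_one (upper_exc K f \<sigma>) \<and> at_most_one (lower_exc K f \<sigma>) \<and>
         (upper_exc K f \<sigma> = {} \<or> lower_exc K f \<sigma> = {}))"


section \<open>The symmetric square of a graph\<close>

datatype 'a graph_cell = Vtx 'a | Edg "'a set"

text \<open>
  \<open>Prod {#a, b#}\<close> is the unordered product of the cells \<open>a\<close> and \<open>b\<close>; \<open>Diag e\<close> and \<open>Tri e\<close> are
  the cells \<open>D(e)\<close> and \<open>C\<^sub>2(e)\<close> into which the image of the square of \<open>e\<close> is divided.
\<close>

datatype 'a sym2_cell = Prod "'a graph_cell multiset" | Diag "'a set" | Tri "'a set"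

abbreviation cprod :: "'a graph_cell \<Rightarrow> 'a graph_cell \<Rightarrow> 'a sym2_cell" (infix "\<otimes>" 70) where
  "a \<otimes> b \<equiv> Prod {#a, b#}"

fun gdim :: "'a graph_cell \<Rightarrow> nat" where
  "gdim (Vtx i) = 0"
| "gdim (Edg e) = 1"

fun sym2_dim :: "'a sym2_cell \<Rightarrow> nat" where
  "sym2_dim (Prod P) = (\<Sum>a\<in>#P. gdim a)"
| "sym2_dim (Diag e) = 1"
| "sym2_dim (Tri e) = 2"

text \<open>Incidences of codimension one; \<open>Sym2\<close> takes their transitive closure as face relation.\<close>

inductive sym2_facet :: "'a sym2_cell \<Rightarrow> 'a sym2_cell \<Rightarrow> bool" where
  product: "i \<in> e \<Longrightarrow> sym2_facet (Vtx i \<otimes> b) (Edg e \<otimes> b)"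
| diagonal: "i \<in> e \<Longrightarrow> sym2_facet (Vtx i \<otimes> Vtx i) (Diag e)"
| leg: "i \<in> e \<Longrightarrow> sym2_facet (Vtx i \<otimes> Edg e) (Tri e)"
| hypotenuse: "sym2_facet (Diag e) (Tri e)"

definition sym2_cells :: "'a set \<Rightarrow> 'a set set \<Rightarrow> 'a sym2_cell set" where
  "sym2_cells V E =
     {Vtx i \<otimes> Vtx j |i j. i \<in> V \<and> j \<in> V} \<union>
     {Vtx i \<otimes> Edg e |i e. i \<in> V \<and> e \<in> E} \<union>
     {Diag e |e. e \<in> E} \<union>
     {Edg e \<otimes> Edg e' |e e'. e \<in> E \<and> e' \<in> E \<and> e \<noteq> e'} \<union>
     {Tri e |e. e \<in> E}"

definition Sym2 :: "'a set \<Rightarrow> 'a set set \<Rightarrow> 'a sym2_cell cell_complex" where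
  "Sym2 V E = \<lparr>cells = sym2_cells V E, cdim = sym2_dim, face = sym2_facet\<^sup>+\<^sup>+\<rparr>"

definition \<Delta> :: "'a set \<Rightarrow> 'a set set \<Rightarrow> 'a sym2_cell set" where
  "\<Delta> V E = {Vtx i \<otimes> Vtx i |i. i \<in> V} \<union> {Diag e |e. e \<in> E}"


section \<open>The functions\<close>

definition f1_vertex :: "nat \<Rightarrow> real" where
  "f1_vertex i = 2 * real i - 2"

fun f1 :: "nat set set \<Rightarrow> nat graph_cell \<Rightarrow> real" where
  "f1 T (Vtx i) = f1_vertex i"
| "f1 T (Edg e) = (if e \<in> T then Max (f1_vertex ` e) else Max (f1_vertex ` e) + 2)"

fun f2 :: "nat set set \<Rightarrow> nat sym2_cell \<Rightarrow> real" where
  "f2 T (Prod P) = (if \<exists>i. P = {#Vtx i, Vtx i#} then - 4 else (\<Sum>a\<in>#P. f1 T a))"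
| "f2 T (Diag e) = - 2"
| "f2 T (Tri e) = 2 * f1 T (Edg e)"

definition f2_tilde :: "nat set \<Rightarrow> nat set set \<Rightarrow> nat sym2_cell \<Rightarrow> real" where
  "f2_tilde V T c =
     (if \<exists>u\<in>V. \<exists>v\<in>V. u \<noteq> 1 \<and> v \<noteq> 1 \<and> u < v \<and>
           (c = Edg (tree_edge T u) \<otimes> Edg (tree_edge T v) \<or> c = Vtx u \<otimes> Edg (tree_edge T v))
      then f2 T c + 1 else f2 T c)"

end

theory Submission imports Defs
begin

text \<open>
  The function is a discrete Morse function because its exceptional incidences - a cell and a
  facet of it on which the function is at least as large - form a discrete vector field. On the
  graph, \<open>f1\<close> pairs each vertex \<open>v \<noteq> 1\<close> with the edge \<open>e(v)\<close> to its parent: both have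
  the value \<open>2v - 2\<close>, whereas in every other incidence of a vertex with an edge the edge is
  larger by at least \<open>2\<close> (\<open>f1_incidence\<close>). The labelling enters through
  \<open>\<tau>(v) < v\<close> (\<open>parent_less\<close>), which holds because the path in the tree from \<open>v\<close> to
  \<open>1\<close> passes through \<open>\<tau>(v)\<close>, so that the traversal cannot meet \<open>v\<close> before \<open>\<tau>(v)\<close>.

  On the symmetric square \<open>f2\<close> alone would pair \<open>u \<times> v\<close> with both \<open>e(u) \<times> v\<close> and
  \<open>u \<times> e(v)\<close>. Raising \<open>u \<times> e(v)\<close> and \<open>e(u) \<times> e(v)\<close> by \<open>1\<close> for \<open>1 < u < v\<close>
  breaks the tie: the pairs become \<open>u \<times> v\<close> with \<open>e(u) \<times> v\<close> and \<open>u \<times> e(v)\<close> with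
  \<open>e(u) \<times> e(v)\<close>, and since other gaps of \<open>f1\<close> are at least \<open>2\<close> nothing else changes.
  The relation \<open>matched\<close> lists the resulting pairs. Every exceptional incidence is one of them
  (\<open>exceptional_matched\<close>), no cell lies in two of them, and none of them involves a cell of the
  diagonal; all three claims follow.
\<close>

section \<open>Paths in trees\<close>

lemma walk_contains_path:
  assumes "is_walk E u p v"
  shows "\<exists>q. is_path E u q v \<and> set q \<subseteq> set p"
  using assms
proof (induction p arbitrary: u)
  case Nil
  then show ?case by (simp add: is_walk_def)
next
  case (Cons x p)
  have [simp]: "x = u" using Cons.prems by (simp add: is_walk_def)
  show ?case
  proof (cases "p = []")
    case True
    then show ?thesis using Cons.prems
      by (intro exI[of _ "[u]"]) (auto simp: is_path_def is_walk_def)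
  next
    case False
    then have edge: "{u, hd p} \<in> E" and "is_walk E (hd p) p v"
      using Cons.prems by (auto simp: is_walk_def successively_Cons)
    then obtain q where q: "is_path E (hd p) q v" "set q \<subseteq> set p"
      using Cons.IH by blast
    show ?thesis
    proof (cases "u \<in> set q")
      case True
      then obtain ys zs where "q = ys @ u # zs" by (auto simp: in_set_conv_decomp)
      then have "is_path E u (u # zs) v" "set (u # zs) \<subseteq> set (x # p)"
        using q by (auto simp: is_path_def is_walk_def successively_append_iff)
      then show ?thesis by blast
    next
      case False
      then have "is_path E u (u # q) v"
        using q edge by (auto simp: is_path_def is_walk_def successively_Cons)
      then show ?thesis using q by (intro exI[of _ "u # q"]) auto
    qed
  qed
qed

lemma path_split:
  assumes "is_path E u p v" "u \<noteq> v"
  obtains w ps where "p = u # w # ps"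
  using assms by (cases p rule: remdups_adj.cases) (auto simp: is_path_def is_walk_def)

text \<open>
  Two paths to the same vertex that separate at once bound a cycle: follow the first one until it
  hits the second one, and return along the latter.
\<close>

lemma second_vertex_unique:
  assumes acyclic: "\<nexists>c. is_cycle T c"
    and p: "is_path T u (u # a # p) v" and q: "is_path T u (u # b # q) v"
  shows "a = b"
proof (rule ccontr)
  assume "a \<noteq> b"
  let ?P = "a # p" and ?Q = "b # q"
  have "v \<in> set ?P" "v \<in> set ?Q"
    using p q last_in_set[of ?P] last_in_set[of ?Q] by (auto simp: is_path_def is_walk_def)
  then obtain xs c ys where P: "?P = xs @ c # ys" "c \<in> set ?Q" "\<forall>x\<in>set xs. x \<notin> set ?Q"
    using split_list_first_prop[of ?P "\<lambda>x. x \<in> set ?Q"] by blast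
  from split_list[OF P(2)] obtain xs' ys' where Q: "?Q = xs' @ c # ys'" by blast
  let ?C = "u # xs @ c # rev xs'"
  have dist: "distinct (u # xs @ c # ys)" "distinct (u # xs' @ c # ys')"
    using p q unfolding P(1) Q is_path_def by auto
  have succ: "successively (\<lambda>x y. {x, y} \<in> T) (u # xs @ c # ys)"
    "successively (\<lambda>x y. {x, y} \<in> T) (u # xs' @ c # ys')"
    using p q unfolding P(1) Q is_path_def is_walk_def by auto
  have "successively (\<lambda>x y. {x, y} \<in> T) ((u # xs) @ [c])"
    using succ(1) successively_append_iff[of "\<lambda>x y. {x, y} \<in> T" "u # xs @ [c]" ys] by auto
  moreover have "successively (\<lambda>x y. {x, y} \<in> T) (rev (xs' @ [c]))"
    unfolding successively_rev insert_commute[of _ _ "{}"]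
    using succ(2) successively_append_iff[of "\<lambda>x y. {x, y} \<in> T" "u # xs' @ [c]" ys']
    by (simp add: successively_Cons)
  ultimately have "successively (\<lambda>x y. {x, y} \<in> T) ((u # xs) @ (c # rev xs'))"
    unfolding successively_append_iff by simp
  then have "successively (\<lambda>x y. {x, y} \<in> T) ?C" by simp
  moreover have "distinct ?C" using dist P(3) unfolding Q by auto
  moreover have "length ?C \<ge> 3"
    using \<open>a \<noteq> b\<close> P(1) Q by (cases xs; cases xs') auto
  moreover have "last ?C = b" using Q by (cases xs') auto
  then have "{last ?C, hd ?C} \<in> T"
    using q by (auto simp: is_path_def is_walk_def insert_commute)
  ultimately have "is_cycle T ?C" unfolding is_cycle_def by blast
  with acyclic show False by blast
qed

lemma parent_eqI:
  assumes "\<nexists>c. is_cycle T c" and "is_path T v (v # w # ps) 1"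
  shows "parent T v = w"
  unfolding parent_def
proof (rule the_equality)
  show "\<exists>ps. is_path T v (v # w # ps) 1" using assms(2) by blast
  show "x = w" if "\<exists>ps. is_path T v (v # x # ps) 1" for x
    using that second_vertex_unique[OF assms(1) _ assms(2)] by blast
qed

lemma simple_graph_edgeD:
  assumes "simple_graph V E" "{a, b} \<in> E"
  shows "a \<in> V" "b \<in> V" "a \<noteq> b"
  using assms by (auto simp: simple_graph_def)

lemma path_to_root:
  assumes "tree V T" "1 \<in> V" "v \<in> V"
  obtains p where "is_path T v p 1"
  using assms walk_contains_path unfolding tree_def connected_graph_def by metis

lemma parent_edge:
  assumes tree: "tree V T" and "1 \<in> V" "v \<in> V" "v \<noteq> 1"
  shows "{v, parent T v} \<in> T"
proof -
  obtain p where p: "is_path T v p 1" using path_to_root assms by blast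
  then obtain w ps where "p = v # w # ps" using path_split assms by metis
  moreover from this p have "parent T v = w"
    using parent_eqI tree unfolding tree_def by blast
  ultimately show ?thesis using p by (auto simp: is_path_def is_walk_def)
qed

text \<open>
  A path from \<open>a\<close> to the root either passes through the neighbour \<open>b\<close>, and then its part
  after \<open>b\<close> can be reached from \<open>a\<close> directly, or it extends to a path from \<open>b\<close>.
\<close>

lemma edge_parent_cases:
  assumes tree: "tree V T" and "1 \<in> V" and ab: "{a, b} \<in> T"
  shows "(a \<noteq> 1 \<and> parent T a = b) \<or> (b \<noteq> 1 \<and> parent T b = a)"
proof -
  have "a \<in> V" "a \<noteq> b" using simple_graph_edgeD tree ab unfolding tree_def by metis+
  then obtain p where p: "is_path T a p 1" using path_to_root assms by blast
  then obtain ps where ps: "p = a # ps" by (cases p) (auto simp: is_path_def is_walk_def)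
  have acyclic: "\<nexists>c. is_cycle T c" using tree by (simp add: tree_def)
  show ?thesis
  proof (cases "b \<in> set ps")
    case True
    then obtain xs ys where "ps = xs @ b # ys" by (auto simp: in_set_conv_decomp)
    then have path: "is_path T a (a # b # ys) 1"
      using p ab ps by (auto simp: is_path_def is_walk_def successively_append_iff successively_Cons)
    then have "a \<noteq> 1" using last_in_set[of "b # ys"] by (auto simp: is_path_def is_walk_def)
    then show ?thesis using parent_eqI[OF acyclic path] by simp
  next
    case False
    then have path: "is_path T b (b # a # ps) 1"
      using p ab ps \<open>a \<noteq> b\<close> by (auto simp: is_path_def is_walk_def insert_commute)
    then have "b \<noteq> 1" using last_in_set[of "a # ps"] by (auto simp: is_path_def is_walk_def)
    then show ?thesis using parent_eqI[OF acyclic path] by simp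
  qed
qed


section \<open>The depth-first labelling\<close>

lemma contour_edge:
  assumes "simple_graph V T" "plane_drawing V T rot" "card (nbrs T r) = 1"
  shows "snd (contour T rot r k) \<in> nbrs T (fst (contour T rot r k))"
proof (induction k)
  case 0
  from assms(3) obtain x where "nbrs T r = {x}" by (auto simp: card_1_singleton_iff)
  then show ?case by simp
next
  case (Suc k)
  obtain u v where uv: "contour T rot r k = (u, v)" by fastforce
  then have "{u, v} \<in> T" using Suc by (simp add: nbrs_def)
  then have "u \<in> nbrs T v" "v \<in> V"
    using simple_graph_edgeD(2)[OF assms(1)] by (auto simp: nbrs_def insert_commute)
  moreover have "cyclic_on (rot v) (nbrs T v)"
    using assms(2) \<open>v \<in> V\<close> by (simp add: plane_drawing_def)
  ultimately show ?case using uv by (auto intro: cyclic_on_inI)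
qed

lemma contour_walk:
  assumes "simple_graph V T" "plane_drawing V T rot" "card (nbrs T r) = 1"
  shows "\<exists>p. is_walk T (fst (contour T rot r k)) p r \<and> set p \<subseteq> (\<lambda>l. fst (contour T rot r l)) ` {..k}"
proof (induction k)
  case 0
  show ?case by (intro exI[of _ "[r]"]) (auto simp: is_walk_def)
next
  case (Suc k)
  then obtain p where p: "is_walk T (fst (contour T rot r k)) p r"
    "set p \<subseteq> (\<lambda>l. fst (contour T rot r l)) ` {..k}" by blast
  let ?x = "fst (contour T rot r (Suc k))"
  have "?x = snd (contour T rot r k)" by (simp add: case_prod_beta)
  then have "{?x, fst (contour T rot r k)} \<in> T"
    using contour_edge[OF assms, of k] by (simp add: nbrs_def insert_commute)
  then have "is_walk T ?x (?x # p) r"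
    using p(1) by (auto simp: is_walk_def successively_Cons)
  moreover have "set (?x # p) \<subseteq> (\<lambda>l. fst (contour T rot r l)) ` {..Suc k}"
    using p(2) by (auto simp: atMost_Suc simp del: contour.simps)
  ultimately show ?case by blast
qed

text \<open>
  If \<open>v\<close> were met before its parent, the traversal up to that moment would contain a path from
  \<open>v\<close> to \<open>1\<close> that avoids the parent.
\<close>

lemma parent_less:
  assumes tree: "tree V T" and plane: "plane_drawing V T rot" and dfs: "dfs_labelled V T rot"
    and v: "v \<in> V" "v \<noteq> 1"
  shows "parent T v < v"
proof (rule ccontr)
  assume "\<not> parent T v < v"
  have simple: "simple_graph V T" and acyclic: "\<nexists>c. is_cycle T c"
    using tree by (auto simp: tree_def)
  have root: "1 \<in> V" "card (nbrs T 1) = 1" using dfs by (auto simp: dfs_labelled_def)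
  have "parent T v \<in> V" "parent T v \<noteq> v"
    using simple_graph_edgeD[OF simple parent_edge[OF tree root(1) v]] by auto
  with \<open>\<not> parent T v < v\<close> v have "met_before T rot 1 v (parent T v)"
    using dfs by (auto simp: dfs_labelled_def)
  then obtain k where k: "fst (contour T rot 1 k) = v"
    "\<forall>l\<le>k. fst (contour T rot 1 l) \<noteq> parent T v" by (auto simp: met_before_def)
  obtain p where p: "is_walk T v p 1" "set p \<subseteq> (\<lambda>l. fst (contour T rot 1 l)) ` {..k}"
    using contour_walk[OF simple plane root(2), of k] unfolding k(1) by blast
  from p(2) k(2) have "parent T v \<notin> set p" by fastforce
  then obtain q where q: "is_path T v q 1" "parent T v \<notin> set q"
    using walk_contains_path[OF p(1)] by blast
  then obtain w ps where "q = v # w # ps" using path_split v by metis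
  with q show False using parent_eqI[OF acyclic, of v w ps] by simp
qed


section \<open>Facets and pairs\<close>

lemma pair_mset_eq_iff [simp]:
  "{#a, b#} = {#c, d#} \<longleftrightarrow> a = c \<and> b = d \<or> a = d \<and> b = c"
  by (auto simp: add_eq_conv_ex)

lemma sym2_facet_dim: "sym2_facet \<sigma> \<tau> \<Longrightarrow> sym2_dim \<tau> = sym2_dim \<sigma> + 1"
  by (induction rule: sym2_facet.induct) auto

lemma sym2_face_dim: "sym2_facet\<^sup>+\<^sup>+ \<sigma> \<tau> \<Longrightarrow> sym2_dim \<sigma> < sym2_dim \<tau>"
  by (induction rule: tranclp_induct) (auto dest: sym2_facet_dim)

lemma sym2_face_codim1:
  assumes "sym2_facet\<^sup>+\<^sup>+ \<sigma> \<tau>" "sym2_dim \<tau> = sym2_dim \<sigma> + 1"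
  shows "sym2_facet \<sigma> \<tau>"
  using assms by (cases rule: tranclp.cases) (auto dest!: sym2_facet_dim sym2_face_dim)

lemma subcomplex_diagonal:
  assumes "simple_graph V E"
  shows "subcomplex (\<Delta> V E) (Sym2 V E)"
proof -
  have facet: "\<tau> \<in> \<Delta> V E \<Longrightarrow> \<sigma> \<in> \<Delta> V E" if "sym2_facet \<sigma> \<tau>" for \<sigma> \<tau>
    using that assms by (cases rule: sym2_facet.cases) (auto simp: \<Delta>_def simple_graph_def)
  have "\<tau> \<in> \<Delta> V E \<longrightarrow> \<sigma> \<in> \<Delta> V E" if "sym2_facet\<^sup>+\<^sup>+ \<sigma> \<tau>" for \<sigma> \<tau>
    using that by (induction rule: tranclp_induct) (auto dest: facet)
  moreover have "\<Delta> V E \<subseteq> sym2_cells V E" by (auto simp: \<Delta>_def sym2_cells_def)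
  ultimately show ?thesis by (auto simp: subcomplex_def Sym2_def)
qed

lemma at_most_oneI: "(\<And>x y. x \<in> A \<Longrightarrow> y \<in> A \<Longrightarrow> x = y) \<Longrightarrow> at_most_one A"
  unfolding at_most_one_def
  by (metis One_nat_def card_le_Suc0_iff_eq finite.emptyI finite_insert finite_subset insertI1 subsetI)


section \<open>The discrete vector field\<close>

locale rooted_labelling =
  fixes n :: nat and E T :: "nat set set"
  assumes simple: "simple_graph {1..n} E"
    and T_subset: "T \<subseteq> E"
    and tree_edge_in_T: "v \<in> {2..n} \<Longrightarrow> tree_edge T v \<in> T"
    and parent_smaller: "v \<in> {2..n} \<Longrightarrow> parent T v < v"
    and T_cover: "e \<in> T \<Longrightarrow> \<exists>v\<in>{2..n}. e = tree_edge T v"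
begin

inductive matched :: "nat sym2_cell \<Rightarrow> nat sym2_cell \<Rightarrow> bool" where
  vertices: "u \<in> {2..n} \<Longrightarrow> u < v \<Longrightarrow>
    matched (Vtx u \<otimes> Vtx v) (Edg (tree_edge T u) \<otimes> Vtx v)"
| root_vertex: "v \<in> {2..n} \<Longrightarrow>
    matched (Vtx 1 \<otimes> Vtx v) (Vtx 1 \<otimes> Edg (tree_edge T v))"
| tree_edges: "u \<in> {2..n} \<Longrightarrow> v \<in> {2..n} \<Longrightarrow> u < v \<Longrightarrow>
    matched (Vtx u \<otimes> Edg (tree_edge T v)) (Edg (tree_edge T u) \<otimes> Edg (tree_edge T v))"
| other_edge: "u \<in> {2..n} \<Longrightarrow> e \<notin> T \<Longrightarrow>
    matched (Vtx u \<otimes> Edg e) (Edg (tree_edge T u) \<otimes> Edg e)"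
| triangle: "v \<in> {2..n} \<Longrightarrow>
    matched (Vtx v \<otimes> Edg (tree_edge T v)) (Tri (tree_edge T v))"

lemma Max_tree_edge: "v \<in> {2..n} \<Longrightarrow> Max (tree_edge T v) = v"
  using parent_smaller[of v] by (simp add: tree_edge_def)

lemma tree_edge_eq_iff:
  assumes "u \<in> {2..n}" "v \<in> {2..n}"
  shows "tree_edge T u = tree_edge T v \<longleftrightarrow> u = v"
  using assms Max_tree_edge by metis

lemma matched_functional: "matched \<sigma> \<tau> \<Longrightarrow> matched \<sigma> \<tau>' \<Longrightarrow> \<tau> = \<tau>'"
  by (auto elim!: matched.cases simp: tree_edge_eq_iff tree_edge_in_T)

lemma matched_injective: "matched \<sigma> \<tau> \<Longrightarrow> matched \<sigma>' \<tau> \<Longrightarrow> \<sigma> = \<sigma>'"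
  by (auto elim!: matched.cases simp: tree_edge_eq_iff tree_edge_in_T)

lemma matched_no_chain: "matched \<rho> \<sigma> \<Longrightarrow> \<not> matched \<sigma> \<tau>"
  by (auto elim!: matched.cases simp: tree_edge_eq_iff tree_edge_in_T)

lemma matched_off_diagonal:
  "matched \<sigma> \<tau> \<Longrightarrow> \<sigma> \<notin> \<Delta> {1..n} E \<and> \<tau> \<notin> \<Delta> {1..n} E"
  by (auto elim!: matched.cases simp: \<Delta>_def)


section \<open>The values of the function\<close>

lemma edge_cases:
  assumes "e \<in> E" "i \<in> e"
  obtains j where "e = {i, j}" "i \<noteq> j" "i \<in> {1..n}" "j \<in> {1..n}"
proof -
  have "card e = 2" "e \<subseteq> {1..n}" using simple assms by (auto simp: simple_graph_def)
  then obtain x y where "e = {x, y}" "x \<noteq> y" "x \<in> {1..n}" "y \<in> {1..n}"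
    by (auto simp: card_2_iff)
  with assms(2) show thesis using that[of x] that[of y] by (auto simp: insert_commute)
qed

lemma f1_tree_edge: "v \<in> {2..n} \<Longrightarrow> f1 T (Edg (tree_edge T v)) = f1_vertex v"
  using parent_smaller[of v] tree_edge_in_T[of v] by (simp add: tree_edge_def f1_vertex_def)

declare f1.simps(2) [simp del]

lemma f1_incidence:
  assumes "e \<in> E" "i \<in> e"
  shows "f1_vertex i + 2 \<le> f1 T (Edg e) \<or> i \<in> {2..n} \<and> e = tree_edge T i"
proof (cases "e \<in> T")
  case True
  then obtain v where v: "v \<in> {2..n}" "e = tree_edge T v" using T_cover by blast
  moreover have "i = v \<or> i < v"
    using assms(2) parent_smaller[OF v(1)] by (auto simp: v(2) tree_edge_def)
  ultimately show ?thesis by (auto simp: f1_tree_edge f1_vertex_def)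
next
  case False
  obtain j where "e = {i, j}" using edge_cases[OF assms] by blast
  with False show ?thesis by (simp add: f1.simps(2))
qed

lemma f1_edge_nonneg:
  assumes "e \<in> E"
  shows "f1 T (Edg e) \<ge> 0"
proof -
  obtain i where "i \<in> e" using simple assms by (fastforce simp: simple_graph_def)
  then obtain j where "e = {i, j}" "i \<in> {1..n}" using edge_cases assms by metis
  then show ?thesis by (auto simp: f1.simps(2) f1_vertex_def max_def)
qed

lemma f2_tilde_Diag: "f2_tilde V T (Diag e) = - 2"
  and f2_tilde_Tri: "f2_tilde V T (Tri e) = 2 * f1 T (Edg e)"
  and f2_tilde_diagonal_vertex: "f2_tilde V T (Vtx i \<otimes> Vtx i) = - 4"
  and f2_tilde_vertices:
    "i \<noteq> j \<Longrightarrow> f2_tilde V T (Vtx i \<otimes> Vtx j) = f1_vertex i + f1_vertex j"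
  by (auto simp: f2_tilde_def)

lemma f2_tilde_vertex_edge:
  "f2_tilde {1..n} T (Vtx i \<otimes> Edg e) = f1_vertex i + f1 T (Edg e) +
    (if i \<in> {2..n} \<and> (\<exists>v\<in>{2..n}. i < v \<and> e = tree_edge T v) then 1 else 0)"
proof -
  have "(\<exists>u\<in>{1..n}. \<exists>v\<in>{1..n}. u \<noteq> 1 \<and> v \<noteq> 1 \<and> u < v \<and>
      (Vtx i \<otimes> Edg e = Edg (tree_edge T u) \<otimes> Edg (tree_edge T v) \<or>
       Vtx i \<otimes> Edg e = Vtx u \<otimes> Edg (tree_edge T v)))
    \<longleftrightarrow> i \<in> {2..n} \<and> (\<exists>v\<in>{2..n}. i < v \<and> e = tree_edge T v)" (is "?L \<longleftrightarrow> ?R")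
  proof
    assume ?R
    then obtain v where "i \<in> {2..n}" "v \<in> {2..n}" "i < v" "e = tree_edge T v" by blast
    then show ?L by (intro bexI[of _ i] bexI[of _ v]) auto
  qed fastforce
  then show ?thesis unfolding f2_tilde_def by simp
qed

lemma f2_tilde_edges:
  assumes "e \<noteq> e'"
  shows "f2_tilde {1..n} T (Edg e \<otimes> Edg e') = f1 T (Edg e) + f1 T (Edg e') +
    (if e \<in> T \<and> e' \<in> T then 1 else 0)"
proof -
  have "(\<exists>u\<in>{1..n}. \<exists>v\<in>{1..n}. u \<noteq> 1 \<and> v \<noteq> 1 \<and> u < v \<and>
      (Edg e \<otimes> Edg e' = Edg (tree_edge T u) \<otimes> Edg (tree_edge T v) \<or>
       Edg e \<otimes> Edg e' = Vtx u \<otimes> Edg (tree_edge T v)))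
    \<longleftrightarrow> e \<in> T \<and> e' \<in> T" (is "?L \<longleftrightarrow> ?R")
  proof
    assume ?L
    then show ?R by (auto simp: tree_edge_in_T)
  next
    assume ?R
    then obtain u v where uv: "u \<in> {2..n}" "e = tree_edge T u" "v \<in> {2..n}" "e' = tree_edge T v"
      using T_cover by meson
    with assms have "u < v \<or> v < u" by auto
    then show ?L
    proof
      assume "u < v"
      with uv show ?L by (intro bexI[of _ u] bexI[of _ v]) auto
    next
      assume "v < u"
      with uv show ?L by (intro bexI[of _ v] bexI[of _ u]) auto
    qed
  qed
  then show ?thesis unfolding f2_tilde_def by simp
qed

declare One_nat_def [simp del]

text \<open>
  Where \<open>f1\<close> has a gap of \<open>2\<close>, the corrections by \<open>1\<close> are too small to make an incidence
  exceptional; where it has none, the facet arises by replacing \<open>e(i)\<close> with \<open>i\<close>, and the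
  corrections decide whether the incidence stays exceptional.
\<close>

lemma exceptional_matched:
  assumes facet: "sym2_facet \<sigma> \<tau>"
    and cells: "\<sigma> \<in> sym2_cells {1..n} E" "\<tau> \<in> sym2_cells {1..n} E"
    and exc: "f2_tilde {1..n} T \<tau> \<le> f2_tilde {1..n} T \<sigma>"
  shows "matched \<sigma> \<tau>"
  using facet
proof cases
  case (product i e b)
  show ?thesis
  proof (cases b)
    case (Vtx j)
    have e: "e \<in> E" and j: "j \<in> {1..n}"
      using cells(2) by (auto simp: product Vtx sym2_cells_def)
    have \<tau>: "\<tau> = Vtx j \<otimes> Edg e" by (simp add: product Vtx add_mset_commute)
    have "i \<noteq> j"
    proof
      assume "i = j"
      then show False using exc f1_edge_nonneg[OF e] j
        by (simp add: \<tau> product(1) Vtx f2_tilde_vertex_edge f2_tilde_diagonal_vertex f1_vertex_def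
            split: if_splits)
    qed
    then have le: "f1 T (Edg e) + (if j \<in> {2..n} \<and> (\<exists>v\<in>{2..n}. j < v \<and> e = tree_edge T v) then 1 else 0)
        \<le> f1_vertex i"
      using exc by (simp add: \<tau> product(1) Vtx f2_tilde_vertex_edge f2_tilde_vertices)
    then have i: "i \<in> {2..n}" "e = tree_edge T i"
      using f1_incidence[OF e product(3)] by (auto split: if_splits)
    have "j = 1 \<or> i < j"
    proof (rule ccontr)
      assume "\<not> (j = 1 \<or> i < j)"
      with \<open>i \<noteq> j\<close> j have "j \<in> {2..n}" "j < i" by auto
      then have "j \<in> {2..n} \<and> (\<exists>v\<in>{2..n}. j < v \<and> e = tree_edge T v)" using i by blast
      with le show False by (simp add: i(2) f1_tree_edge[OF i(1)])
    qed
    then show ?thesis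
    proof
      assume "j = 1"
      then show ?thesis using root_vertex[OF i(1)]
        by (simp add: \<tau> product(1) Vtx i(2) add_mset_commute)
    next
      assume "i < j"
      then show ?thesis using vertices[OF i(1)] by (simp add: product Vtx i(2))
    qed
  next
    case (Edg e')
    have e: "e \<in> E" "e' \<in> E" "e \<noteq> e'"
      using cells(2) by (auto simp: product Edg sym2_cells_def)
    have le: "f1 T (Edg e) + (if e \<in> T \<and> e' \<in> T then 1 else 0)
        \<le> f1_vertex i + (if i \<in> {2..n} \<and> (\<exists>v\<in>{2..n}. i < v \<and> e' = tree_edge T v) then 1 else 0)"
      using exc by (simp add: product Edg f2_tilde_vertex_edge f2_tilde_edges[OF e(3)])
    then have i: "i \<in> {2..n}" "e = tree_edge T i"
      using f1_incidence[OF e(1) product(3)] by (auto split: if_splits)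
    show ?thesis
    proof (cases "e' \<in> T")
      case True
      then obtain v where "v \<in> {2..n}" "i < v" "e' = tree_edge T v"
        using le i tree_edge_in_T by (auto simp: f1_tree_edge split: if_splits)
      then show ?thesis using tree_edges i by (simp add: product Edg)
    next
      case False
      then show ?thesis using other_edge i by (simp add: product Edg)
    qed
  qed
next
  case (diagonal i e)
  then show ?thesis using exc by (simp add: f2_tilde_Diag f2_tilde_diagonal_vertex)
next
  case (leg i e)
  then have e: "e \<in> E" using cells by (auto simp: sym2_cells_def)
  have "f1 T (Edg e) \<le> f1_vertex i + 1"
    using exc by (simp add: leg f2_tilde_Tri f2_tilde_vertex_edge split: if_splits)
  then show ?thesis using f1_incidence[OF e leg(3)] triangle by (auto simp: leg)
next
  case (hypotenuse e)
  then show ?thesis using exc cells f1_edge_nonneg[of e]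
    by (auto simp: f2_tilde_Diag f2_tilde_Tri sym2_cells_def)
qed

section \<open>The Morse property\<close>

lemma upper_exc_matched:
  assumes "\<sigma> \<in> cells (Sym2 {1..n} E)"
    and "\<tau> \<in> upper_exc (Sym2 {1..n} E) (f2_tilde {1..n} T) \<sigma>"
  shows "matched \<sigma> \<tau>"
  using assms exceptional_matched sym2_face_codim1 by (auto simp: upper_exc_def Sym2_def)

lemma lower_exc_matched:
  assumes "\<sigma> \<in> cells (Sym2 {1..n} E)"
    and "\<nu> \<in> lower_exc (Sym2 {1..n} E) (f2_tilde {1..n} T) \<sigma>"
  shows "matched \<nu> \<sigma>"
  using assms exceptional_matched sym2_face_codim1 by (auto simp: lower_exc_def Sym2_def)

text \<open>
  Removing a subcomplex can only shrink the two exceptional sets of a remaining cell. Stating the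
  bounds for arbitrary subsets covers the closed and the open complex at once.
\<close>

lemma at_most_one_exc:
  assumes "\<sigma> \<in> cells (Sym2 {1..n} E)"
    and "A \<subseteq> upper_exc (Sym2 {1..n} E) (f2_tilde {1..n} T) \<sigma>"
    and "B \<subseteq> lower_exc (Sym2 {1..n} E) (f2_tilde {1..n} T) \<sigma>"
  shows "at_most_one A" "at_most_one B" "A = {} \<or> B = {}"
proof -
  have A: "matched \<sigma> \<tau>" if "\<tau> \<in> A" for \<tau> using upper_exc_matched assms that by blast
  have B: "matched \<nu> \<sigma>" if "\<nu> \<in> B" for \<nu> using lower_exc_matched assms that by blast
  show "at_most_one A" using A matched_functional by (blast intro: at_most_oneI)
  show "at_most_one B" using B matched_injective by (blast intro: at_most_oneI)
  show "A = {} \<or> B = {}" using A B matched_no_chain by blast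
qed

lemma discrete_Morse_f2_tilde: "discrete_Morse (Sym2 {1..n} E) (f2_tilde {1..n} T)"
  using at_most_one_exc[OF _ order_refl order_refl] by (simp add: discrete_Morse_def)

lemma critical_diagonal:
  assumes "\<sigma> \<in> \<Delta> {1..n} E"
  shows "critical (Sym2 {1..n} E) (f2_tilde {1..n} T) \<sigma>"
proof -
  have "\<sigma> \<in> cells (Sym2 {1..n} E)"
    using subcomplex_diagonal[OF simple] assms by (auto simp: subcomplex_def)
  then show ?thesis
    using assms matched_off_diagonal upper_exc_matched lower_exc_matched
    unfolding critical_def by blast
qed

lemma open_discrete_Morse_f2_tilde:
  assumes "n \<ge> 1"
  shows "open_discrete_Morse (Sym2 {1..n} E) (\<Delta> {1..n} E) (f2_tilde {1..n} T)"
proof -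
  let ?X = "Sym2 {1..n} E" and ?f = "f2_tilde {1..n} T"
  let ?K = "open_complex ?X (\<Delta> {1..n} E)"
  have sub: "upper_exc ?K ?f \<sigma> \<subseteq> upper_exc ?X ?f \<sigma>" "lower_exc ?K ?f \<sigma> \<subseteq> lower_exc ?X ?f \<sigma>" for \<sigma>
    by (auto simp: upper_exc_def lower_exc_def open_complex_def)
  have "cells ?K \<subseteq> cells ?X" by (auto simp: open_complex_def)
  then have "\<forall>\<sigma>\<in>cells ?K. at_most_one (upper_exc ?K ?f \<sigma>) \<and> at_most_one (lower_exc ?K ?f \<sigma>) \<and>
      (upper_exc ?K ?f \<sigma> = {} \<or> lower_exc ?K ?f \<sigma> = {})"
    using at_most_one_exc[OF _ sub] by blast
  moreover have "\<Delta> {1..n} E \<noteq> {}" using assms by (auto simp: \<Delta>_def)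
  ultimately show ?thesis
    using subcomplex_diagonal[OF simple] by (simp add: open_discrete_Morse_def Let_def)
qed

end

lemma rooted_labellingI:
  assumes "simple_graph {1..n} E" and span: "spanning_tree {1..n} E T"
    and plane: "plane_drawing {1..n} T rot" and dfs: "dfs_labelled {1..n} T rot"
  shows "rooted_labelling n E T"
proof
  have tree: "tree {1..n} T" and sub: "T \<subseteq> E" using span by (auto simp: spanning_tree_def)
  then have T: "simple_graph {1..n} T" by (simp add: tree_def)
  have root: "1 \<in> {1..n}" using dfs by (simp add: dfs_labelled_def)
  show "simple_graph {1..n} E" by fact
  show "T \<subseteq> E" by fact
  show "tree_edge T v \<in> T" if "v \<in> {2..n}" for v
    using parent_edge[OF tree root, of v] that by (simp add: tree_edge_def)
  show "parent T v < v" if "v \<in> {2..n}" for v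
    using parent_less[OF tree plane dfs, of v] that by simp
  show "\<exists>v\<in>{2..n}. e = tree_edge T v" if "e \<in> T" for e
  proof -
    have "card e = 2" using T that by (simp add: simple_graph_def)
    then obtain a b where e: "e = {a, b}" by (auto simp: card_2_iff)
    have "a \<in> {1..n}" "b \<in> {1..n}"
      using simple_graph_edgeD[OF T \<open>e \<in> T\<close>[unfolded e]] by auto
    then have "a \<noteq> 1 \<Longrightarrow> a \<in> {2..n}" "b \<noteq> 1 \<Longrightarrow> b \<in> {2..n}" by auto
    moreover have "a \<noteq> 1 \<and> e = tree_edge T a \<or> b \<noteq> 1 \<and> e = tree_edge T b"
      using edge_parent_cases[OF tree root \<open>e \<in> T\<close>[unfolded e]]
      by (auto simp: e tree_edge_def insert_commute)
    ultimately show ?thesis by metis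
  qed
qed

theorem mainTheorem2:
  fixes n :: nat and E T :: "nat set set" and rot :: "nat \<Rightarrow> nat \<Rightarrow> nat"
  assumes "simple_graph {1..n} E" and "connected_graph {1..n} E"
    and "spanning_tree {1..n} E T"
    and "plane_drawing {1..n} T rot"
    and "dfs_labelled {1..n} T rot"
  shows "discrete_Morse (Sym2 {1..n} E) (f2_tilde {1..n} T)
    \<and> (\<forall>\<sigma>\<in>\<Delta> {1..n} E. critical (Sym2 {1..n} E) (f2_tilde {1..n} T) \<sigma>)
    \<and> open_discrete_Morse (Sym2 {1..n} E) (\<Delta> {1..n} E) (f2_tilde {1..n} T)"
proof -
  interpret rooted_labelling n E T by (rule rooted_labellingI) fact+
  have "n \<ge> 1" using assms(5) by (simp add: dfs_labelled_def)
  then show ?thesis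
    using discrete_Morse_f2_tilde critical_diagonal open_discrete_Morse_f2_tilde by blast
qed

end
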